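(* (1) Let $A$ and $B$ be infinite subsets of $\Sigma^*$ with $B$ recursive. Then $A$ is $\mathrm{F}_{\mathrm{PR}}$-compressible to $B$ if and only if $A$ is $\mathrm{F}_{\mathrm{PR}}$-compressible to $\Sigma^*$. (2) Let $A$ and $B$ be infinite subsets of $\Sigma^*$ with $B$ recursively enumerable. If $A$ is $\mathrm{F}_{\mathrm{PR}}$-compressible to $\Sigma^*$, then $A$ is $\mathrm{F}_{\mathrm{PR}}$-compressible to $B$; moreover, this can be witnessed by a compression function $f$ for $A$ to $B$ that additionally satisfies $f(\Sigma^* )=B$. (3) There exist infinite sets $A, B\subseteq\Sigma^*$ with $B$ recursively enumerable such that $A$ is $\mathrm{F}_{\mathrm{REC}}$-compressible to $B$ but $A$ is not $\mathrm{F}_{\mathrm{REC}}$-compressible to $\Sigma^*$.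
   Context: $\Sigma=\{0,1\}$. $\mathrm{F}_{\mathrm{REC}}$ is the class of total recursive functions from $\Sigma^*$ to $\Sigma^*$ and $\mathrm{F}_{\mathrm{PR}}$ the class of partial recursive functions from $\Sigma^*$ to $\Sigma^*$. Given sets $A, B\subseteq\Sigma^*$, a (possibly partial) function $f$ is a compression function for $A$ to $B$ if (a) $\mathrm{domain}(f)\supseteq A$, (b) $f(A)=B$, and (c) for all $a\neq b$ in $A$, $f(a)\neq f(b)$. For a class $\mathcal F$ of (possibly partial) functions, $A$ is $\mathcal F$-compressible to $B$ if some $f\in\mathcal F$ is a compression function for $A$ to $B$. *)

theory Defs imports Main begin

type_synonym word = "bool list"

text \<open>
  Kleene's partial recursive functions. An n-ary partial function on the natural numbers is
  represented by a function on lists, of which only the values on lists of length n matter.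
\<close>

definition pr_comp ::
    "(nat list \<Rightarrow> nat option) \<Rightarrow> (nat list \<Rightarrow> nat option) list \<Rightarrow> nat list \<Rightarrow> nat option" where
  "pr_comp f gs xs =
     (if \<forall>g\<in>set gs. g xs \<noteq> None then f (map (\<lambda>g. the (g xs)) gs) else None)"

primrec pr_rec ::
    "(nat list \<Rightarrow> nat option) \<Rightarrow> (nat list \<Rightarrow> nat option) \<Rightarrow> nat \<Rightarrow> nat list \<Rightarrow> nat option" where
  "pr_rec f g 0 xs = f xs"
| "pr_rec f g (Suc y) xs =
     (case pr_rec f g y xs of None \<Rightarrow> None | Some r \<Rightarrow> g (y # r # xs))"

text \<open>The search diverges if some value is undefined before the first zero is reached.\<close>

definition pr_min :: "(nat list \<Rightarrow> nat option) \<Rightarrow> nat list \<Rightarrow> nat option" where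
  "pr_min f xs =
     (if \<exists>y. f (y # xs) = Some 0 \<and> (\<forall>z<y. f (z # xs) \<noteq> None)
      then Some (LEAST y. f (y # xs) = Some 0) else None)"

inductive partial_recursive :: "nat \<Rightarrow> (nat list \<Rightarrow> nat option) \<Rightarrow> bool" where
  zero: "partial_recursive n (\<lambda>xs. Some 0)"
| succ: "partial_recursive 1 (\<lambda>xs. Some (Suc (xs ! 0)))"
| proj: "i < n \<Longrightarrow> partial_recursive n (\<lambda>xs. Some (xs ! i))"
| comp: "partial_recursive (length gs) f \<Longrightarrow> (\<And>g. g \<in> set gs \<Longrightarrow> partial_recursive n g) \<Longrightarrow>
    partial_recursive n (pr_comp f gs)"
| prim_rec: "partial_recursive n f \<Longrightarrow> partial_recursive (Suc (Suc n)) g \<Longrightarrow>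
    partial_recursive (Suc n) (\<lambda>xs. pr_rec f g (hd xs) (tl xs))"
| minim: "partial_recursive (Suc n) f \<Longrightarrow> partial_recursive n (pr_min f)"

text \<open>
  The position of a word in the length-lexicographic order of all words
  (bijective base-2 numeration), used to transfer computability from numbers to words.
\<close>

definition word_code :: "word \<Rightarrow> nat" where
  "word_code w = foldl (\<lambda>n b. 2 * n + (if b then 2 else 1)) 0 w"

lemma word_code_Nil [simp]: "word_code [] = 0"
  by (simp add: word_code_def)

lemma word_code_snoc [simp]: "word_code (w @ [b]) = 2 * word_code w + (if b then 2 else 1)"
  by (simp add: word_code_def)

lemma bij_word_code: "bij word_code"
proof (rule bijI)
  show "inj word_code"
  proof (rule injI)
    fix v w :: word
    show "word_code v = word_code w \<Longrightarrow> v = w"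
    proof (induction v arbitrary: w rule: rev_induct)
      case Nil
      then show ?case by (cases w rule: rev_cases) (auto split: if_splits)
    next
      case (snoc b v)
      then obtain u c where w: "w = u @ [c]"
        by (cases w rule: rev_cases) (auto split: if_splits)
      have eq: "2 * word_code v + (if b then 2 else 1) = 2 * word_code u + (if c then 2 else 1)"
        using snoc.prems w by simp
      have "b = c" using eq by (auto split: if_splits) presburger+
      moreover have "v = u" using snoc.IH[of u] eq calculation by simp
      ultimately show ?case using w by simp
    qed
  qed
  show "surj word_code"
  proof -
    have "\<exists>w. word_code w = n" for n
    proof (induction n rule: less_induct)
      case (less n)
      show ?case
      proof (cases "n = 0")
        case True
        then show ?thesis by (intro exI[of _ "[]"]) simp
      next
        case False
        then have "(n - 1) div 2 < n" by simp
        then obtain w where w: "word_code w = (n - 1) div 2" using less.IH by blast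
        have "word_code (w @ [even n]) = n" using w False by simp presburger
        then show ?thesis by blast
      qed
    qed
    then show ?thesis by (metis surjI)
  qed
qed

definition F_PR :: "(word \<rightharpoonup> word) set" where
  "F_PR = {f. \<exists>g. partial_recursive 1 g \<and>
                (\<forall>w. g [word_code w] = map_option word_code (f w))}"

definition F_REC :: "(word \<rightharpoonup> word) set" where
  "F_REC = {f \<in> F_PR. dom f = UNIV}"

definition recursive_set :: "word set \<Rightarrow> bool" where
  "recursive_set B \<longleftrightarrow> (\<lambda>w. Some (if w \<in> B then [True] else [False])) \<in> F_REC"

definition re_set :: "word set \<Rightarrow> bool" where
  "re_set B \<longleftrightarrow> (\<exists>f\<in>F_PR. dom f = B)"

definition compression_function :: "(word \<rightharpoonup> word) \<Rightarrow> word set \<Rightarrow> word set \<Rightarrow> bool" where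
  "compression_function f A B \<longleftrightarrow>
     A \<subseteq> dom f \<and> ran (f |` A) = B \<and> (\<forall>a\<in>A. \<forall>b\<in>A. a \<noteq> b \<longrightarrow> f a \<noteq> f b)"

definition compressible :: "(word \<rightharpoonup> word) set \<Rightarrow> word set \<Rightarrow> word set \<Rightarrow> bool" where
  "compressible F A B \<longleftrightarrow> (\<exists>f\<in>F. compression_function f A B)"

end

(*
  Part (1), forwards: compose the compression function with the rank function of the decidable
  set B. Backwards, and part (2): an infinite recursively enumerable B is the range of an injective
  total recursive k on the set of all words; compose the compression function with k, whose range is B.

  Part (3): take A = B = K recursively enumerable but not recursive, with the identity. If a total
  recursive f mapped K injectively onto all words, K would be recursive: given x, enumerate K until
  some v with f v = f x appears (it does, since f is onto on K); then x is in K iff x = v.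

  A non-recursive K, and the enumeration of B = dom f, both rest on a coding of the partial
  recursive functions whose evaluation relation is recursively enumerable.
*)

theory Submission
  imports Defs "HOL-Library.Nat_Bijection" "HOL-Library.Infinite_Set"
begin

section \<open>Total recursive functions\<close>

text \<open>The predicate \<open>partial_recursive\<close> classifies functions, not programs, so it
  gives no handle on running a function for a bounded time. Listing \<open>dom f\<close> needs
  exactly that, since a single divergent argument would block a naive listing. Codes with the
  relation \<open>eval\<close> restore a syntax whose derivations can be cut off at a stage; packing
  argument lists into one number lets a single relation serve every arity.

  All computations are done on numbers. Since \<open>word_code\<close> is a bijection, words are
  reached by conjugation at the very end.

  Part (3) turns on totality. The inverse of an injective recursive enumeration compresses K to all
  words, but it diverges outside K. A total f must also give a value outside K, and that value is
  already taken by a member of K; this collision is what makes the decision procedure stop on every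
  input.\<close>

definition recursive_fun :: "nat \<Rightarrow> (nat list \<Rightarrow> nat) \<Rightarrow> bool" where
  "recursive_fun n F \<longleftrightarrow>
     (\<exists>g. partial_recursive n g \<and> (\<forall>xs. length xs = n \<longrightarrow> g xs = Some (F xs)))"

lemma recursive_fun_cong:
  "recursive_fun n F \<Longrightarrow> (\<And>xs. length xs = n \<Longrightarrow> F xs = G xs) \<Longrightarrow> recursive_fun n G"
  by (auto simp: recursive_fun_def)

lemma recursive_fun_proj: "i < n \<Longrightarrow> recursive_fun n (\<lambda>xs. xs ! i)"
  using partial_recursive.proj by (auto simp: recursive_fun_def)

lemma recursive_fun_Suc: "recursive_fun (Suc 0) (\<lambda>xs. Suc (xs ! 0))"
  using partial_recursive.succ by (auto simp: recursive_fun_def)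

lemma recursive_fun_comp:
  assumes "recursive_fun (length Gs) F" and "\<And>G. G \<in> set Gs \<Longrightarrow> recursive_fun n G"
  shows "recursive_fun n (\<lambda>xs. F (map (\<lambda>G. G xs) Gs))"
proof -
  obtain f where f: "partial_recursive (length Gs) f"
      "\<And>xs. length xs = length Gs \<Longrightarrow> f xs = Some (F xs)"
    using assms(1) by (auto simp: recursive_fun_def)
  have "\<forall>G\<in>set Gs. \<exists>g. partial_recursive n g \<and> (\<forall>xs. length xs = n \<longrightarrow> g xs = Some (G xs))"
    using assms(2) by (simp add: recursive_fun_def)
  then obtain h where h: "\<And>G. G \<in> set Gs \<Longrightarrow> partial_recursive n (h G)"
      "\<And>G xs. G \<in> set Gs \<Longrightarrow> length xs = n \<Longrightarrow> h G xs = Some (G xs)"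
    by (metis bchoice)
  have "partial_recursive n (pr_comp f (map h Gs))"
    using f(1) h(1) by (intro partial_recursive.comp) auto
  moreover have "pr_comp f (map h Gs) xs = Some (F (map (\<lambda>G. G xs) Gs))" if "length xs = n" for xs
  proof -
    have "pr_comp f (map h Gs) xs = f (map (\<lambda>g. the (g xs)) (map h Gs))"
      using h(2) that by (simp add: pr_comp_def)
    also have "map (\<lambda>g. the (g xs)) (map h Gs) = map (\<lambda>G. G xs) Gs"
      using h(2) that by simp
    finally show ?thesis
      by (simp add: f(2))
  qed
  ultimately show ?thesis
    by (auto simp: recursive_fun_def)
qed

lemma recursive_fun_comp1:
  assumes "recursive_fun (Suc 0) F" and "recursive_fun n G"
  shows "recursive_fun n (\<lambda>xs. F [G xs])"
  using recursive_fun_comp[of "[G]" F n] assms by simp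

lemma recursive_fun_comp2:
  assumes "recursive_fun 2 F" and "recursive_fun n G" and "recursive_fun n H"
  shows "recursive_fun n (\<lambda>xs. F [G xs, H xs])"
  using recursive_fun_comp[of "[G, H]" F n] assms by (auto simp: numeral_2_eq_2)

lemma recursive_fun_rec:
  assumes "recursive_fun n F" and "recursive_fun (Suc (Suc n)) G"
  shows "recursive_fun (Suc n)
           (\<lambda>xs. rec_nat (F (tl xs)) (\<lambda>y r. G (y # r # tl xs)) (hd xs))"
proof -
  obtain f g where f: "partial_recursive n f" "\<And>xs. length xs = n \<Longrightarrow> f xs = Some (F xs)"
    and g: "partial_recursive (Suc (Suc n)) g"
      "\<And>xs. length xs = Suc (Suc n) \<Longrightarrow> g xs = Some (G xs)"
    using assms by (auto simp: recursive_fun_def)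
  have "pr_rec f g y xs = Some (rec_nat (F xs) (\<lambda>y r. G (y # r # xs)) y)" if "length xs = n" for y xs
    using that by (induction y) (auto simp: f(2) g(2))
  then show ?thesis
    using partial_recursive.prim_rec[OF f(1) g(1)] by (auto simp: recursive_fun_def)
qed

definition computable :: "(nat \<Rightarrow> nat) \<Rightarrow> bool" where
  "computable F \<longleftrightarrow> recursive_fun (Suc 0) (\<lambda>xs. F (xs ! 0))"

definition computable2 :: "(nat \<Rightarrow> nat \<Rightarrow> nat) \<Rightarrow> bool" where
  "computable2 F \<longleftrightarrow> recursive_fun 2 (\<lambda>xs. F (xs ! 0) (xs ! 1))"

lemma recursive_fun_op1:
  assumes "computable F" and "recursive_fun n G"
  shows "recursive_fun n (\<lambda>xs. F (G xs))"
  using recursive_fun_comp1[of "\<lambda>xs. F (xs ! 0)"] assms by (simp add: computable_def)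

lemma recursive_fun_op2:
  assumes "computable2 F" and "recursive_fun n G" and "recursive_fun n H"
  shows "recursive_fun n (\<lambda>xs. F (G xs) (H xs))"
  using recursive_fun_comp2[of "\<lambda>xs. F (xs ! 0) (xs ! 1)"] assms by (simp add: computable2_def)

lemma recursive_fun_const: "recursive_fun n (\<lambda>xs. c)"
proof (induction c)
  case 0
  then show ?case
    using partial_recursive.zero by (auto simp: recursive_fun_def)
next
  case (Suc c)
  then show ?case
    using recursive_fun_comp1[OF recursive_fun_Suc] by simp
qed

text \<open>Collects rules whose operands are themselves functions of one argument, so that
  \<open>intro\<close> descends through a whole term. Bound variables are packed into that argument
  by \<open>pair\<close>.\<close>

named_theorems computable_intros

lemma computable_id [computable_intros]: "computable (\<lambda>x. x)"
  by (simp add: computable_def recursive_fun_proj)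

lemma computable_const [computable_intros]: "computable (\<lambda>x. c)"
  by (simp add: computable_def recursive_fun_const)

lemma computable_comp: "computable F \<Longrightarrow> computable G \<Longrightarrow> computable (\<lambda>x. F (G x))"
  using recursive_fun_op1[of F "Suc 0" "\<lambda>xs. G (xs ! 0)"] by (simp add: computable_def)

lemma computable_comp2:
  "computable2 F \<Longrightarrow> computable G \<Longrightarrow> computable H \<Longrightarrow> computable (\<lambda>x. F (G x) (H x))"
  unfolding computable_def by (rule recursive_fun_op2)

lemma computable_Suc_fun: "computable Suc"
  using recursive_fun_Suc by (simp add: computable_def)

lemmas computable_Suc [computable_intros] = computable_comp[OF computable_Suc_fun]

lemma computable_iterate:
  assumes "computable2 g"
  shows "computable (rec_nat c g)"
proof -
  have "recursive_fun (Suc 0)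
          (\<lambda>xs. rec_nat ((\<lambda>_. c) (tl xs)) (\<lambda>y r. (\<lambda>ys. g (ys ! 0) (ys ! 1)) (y # r # tl xs)) (hd xs))"
    using assms by (intro recursive_fun_rec recursive_fun_const) (simp add: computable2_def numeral_2_eq_2)
  then show ?thesis
    unfolding computable_def by (rule recursive_fun_cong) (auto simp: length_Suc_conv)
qed

lemma computable2_iterate:
  assumes "computable f" and "recursive_fun 3 (\<lambda>xs. g (xs ! 0) (xs ! 1) (xs ! 2))"
  shows "computable2 (\<lambda>n x. rec_nat (f x) (\<lambda>y r. g y r x) n)"
proof -
  have "recursive_fun (Suc (Suc 0)) (\<lambda>xs. rec_nat ((\<lambda>ys. f (ys ! 0)) (tl xs))
          (\<lambda>y r. (\<lambda>ys. g (ys ! 0) (ys ! 1) (ys ! 2)) (y # r # tl xs)) (hd xs))"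
    using assms by (intro recursive_fun_rec) (simp_all add: computable_def numeral_3_eq_3)
  then show ?thesis
    unfolding computable2_def numeral_2_eq_2
    by (rule recursive_fun_cong) (auto simp: length_Suc_conv)
qed

section \<open>Arithmetic operations\<close>

lemma computable2_plus: "computable2 (+)"
proof -
  have "computable2 (\<lambda>n x. rec_nat x (\<lambda>y r. Suc r) n)"
    by (intro computable2_iterate computable_id recursive_fun_op1[OF computable_Suc_fun]
        recursive_fun_proj) simp
  moreover have "rec_nat x (\<lambda>y r. Suc r) n = n + x" for n x
    by (induction n) auto
  ultimately show ?thesis
    by simp
qed

lemmas computable_plus [computable_intros] = computable_comp2[OF computable2_plus]

lemma computable2_times: "computable2 (*)"
proof -
  have "computable2 (\<lambda>n x. rec_nat 0 (\<lambda>y r. r + x) n)"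
    by (intro computable2_iterate computable_const recursive_fun_op2[OF computable2_plus]
        recursive_fun_proj) simp_all
  moreover have "rec_nat 0 (\<lambda>y r. r + x) n = n * x" for n x :: nat
    by (induction n) auto
  ultimately show ?thesis
    by simp
qed

lemmas computable_times [computable_intros] = computable_comp2[OF computable2_times]

lemma computable_pred: "computable (\<lambda>n. n - 1)"
proof -
  have "computable (rec_nat 0 (\<lambda>y r. y))"
    by (rule computable_iterate) (simp add: computable2_def recursive_fun_proj)
  moreover have "rec_nat 0 (\<lambda>y r. y) n = n - 1" for n
    by (cases n) auto
  ultimately show ?thesis
    by (simp add: computable_def)
qed

lemma computable2_minus: "computable2 (-)"
proof -
  have "computable2 (\<lambda>n x. rec_nat x (\<lambda>y r. r - 1) n)"
    by (intro computable2_iterate computable_id recursive_fun_op1[OF computable_pred]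
        recursive_fun_proj) simp
  moreover have "rec_nat x (\<lambda>y r. r - 1) n = x - n" for n x :: nat
    by (induction n) auto
  ultimately have "computable2 (\<lambda>n x. x - n)"
    by simp
  \<comment> \<open>The recursion runs on the subtrahend, which therefore stands first; the
    projections swap the two arguments.\<close>
  then have "recursive_fun 2 (\<lambda>xs. xs ! 0 - xs ! 1)"
    by (rule recursive_fun_op2) (simp_all add: recursive_fun_proj)
  then show ?thesis
    by (simp add: computable2_def)
qed

lemmas computable_minus [computable_intros] = computable_comp2[OF computable2_minus]

section \<open>Pairing\<close>

abbreviation pair :: "nat \<Rightarrow> nat \<Rightarrow> nat" where
  "pair a b \<equiv> prod_encode (a, b)"

definition pfst :: "nat \<Rightarrow> nat" where "pfst z = fst (prod_decode z)"
definition psnd :: "nat \<Rightarrow> nat" where "psnd z = snd (prod_decode z)"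

lemma pfst_pair [simp]: "pfst (pair a b) = a"
  by (simp add: pfst_def)

lemma psnd_pair [simp]: "psnd (pair a b) = b"
  by (simp add: psnd_def)

lemma pair_collapse [simp]: "pair (pfst z) (psnd z) = z"
  by (simp add: pfst_def psnd_def)

lemma eq_pair_iff: "z = pair a b \<longleftrightarrow> pfst z = a \<and> psnd z = b"
  by auto

lemma computable_triangle: "computable triangle"
proof -
  have "computable (rec_nat 0 (\<lambda>y r. r + Suc y))"
    by (rule computable_iterate)
      (auto simp: computable2_def intro!: recursive_fun_op2[OF computable2_plus]
        recursive_fun_op1[OF computable_Suc_fun] recursive_fun_proj)
  moreover have "rec_nat 0 (\<lambda>y r. r + Suc y) n = triangle n" for n
    by (induction n) (auto simp: triangle_Suc)
  ultimately show ?thesis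
    by (simp add: computable_def)
qed

lemma computable2_pair: "computable2 pair"
  unfolding prod_encode_def case_prod_conv computable2_def
  by (intro recursive_fun_op2[OF computable2_plus] recursive_fun_op1[OF computable_triangle]
      recursive_fun_proj) simp_all

lemmas computable_pair [computable_intros] = computable_comp2[OF computable2_pair]

text \<open>
  The antidiagonal \<open>w = a + b\<close> through \<open>z = pair a b\<close> is the largest number with
  \<open>triangle w \<le> z\<close>. It grows by at most one from \<open>z\<close> to \<open>z + 1\<close>;
  truncated subtraction serves as the test for growth.
\<close>

definition antidiagonal :: "nat \<Rightarrow> nat" where
  "antidiagonal = rec_nat 0 (\<lambda>z w. w + (1 - (triangle (Suc w) - Suc z)))"

lemma antidiagonal_bounds: "triangle (antidiagonal z) \<le> z \<and> z < triangle (Suc (antidiagonal z))"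
proof (induction z)
  case 0
  then show ?case
    by (simp add: antidiagonal_def)
next
  case (Suc z)
  have step: "antidiagonal (Suc z) = antidiagonal z + (1 - (triangle (Suc (antidiagonal z)) - Suc z))"
    by (simp add: antidiagonal_def)
  show ?case
  proof (cases "triangle (Suc (antidiagonal z)) \<le> Suc z")
    case True
    then have "antidiagonal (Suc z) = Suc (antidiagonal z)"
      using step by simp
    then show ?thesis
      using Suc True by simp
  next
    case False
    then have "antidiagonal (Suc z) = antidiagonal z"
      using step by simp
    then show ?thesis
      using Suc False by simp
  qed
qed

lemma triangle_mono: "m \<le> n \<Longrightarrow> triangle m \<le> triangle n"
  by (rule lift_Suc_mono_le[of triangle]) (auto simp: triangle_Suc)

text \<open>By definition \<open>pair a b\<close> is \<open>triangle (a + b) + a\<close>, which lies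
  between two consecutive triangular numbers; monotonicity of \<open>triangle\<close> leaves only
  one index for this.\<close>

lemma antidiagonal_pair: "antidiagonal (pair a b) = a + b"
proof -
  have *: "triangle (a + b) \<le> pair a b" "pair a b < triangle (Suc (a + b))"
    by (auto simp: prod_encode_def triangle_Suc)
  then have "\<not> Suc (a + b) \<le> antidiagonal (pair a b)" "\<not> Suc (antidiagonal (pair a b)) \<le> a + b"
    using antidiagonal_bounds[of "pair a b"] triangle_mono
    by (meson leD le_less_trans less_le_trans)+
  then show ?thesis
    by simp
qed

lemma computable_antidiagonal: "computable antidiagonal"
  unfolding antidiagonal_def
proof (rule computable_iterate)
  show "computable2 (\<lambda>z w. w + (1 - (triangle (Suc w) - Suc z)))"
    unfolding computable2_def
    by (intro recursive_fun_op2[OF computable2_plus] recursive_fun_op2[OF computable2_minus] recursive_fun_const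
        recursive_fun_op1[OF computable_triangle] recursive_fun_op1[OF computable_Suc_fun]
        recursive_fun_proj) simp_all
qed

lemma pfst_eq: "pfst z = z - triangle (antidiagonal z)"
proof -
  have "triangle (pfst z + psnd z) + pfst z = z"
    using pair_collapse[of z] unfolding prod_encode_def by simp
  then show ?thesis
    using antidiagonal_pair[of "pfst z" "psnd z"] by simp
qed

lemma psnd_eq: "psnd z = antidiagonal z - pfst z"
  using antidiagonal_pair[of "pfst z" "psnd z"] by simp

lemma computable_pfst_fun: "computable pfst"
proof -
  have "computable (\<lambda>z. z - triangle (antidiagonal z))"
    by (intro computable_minus computable_id computable_comp[OF computable_triangle]
        computable_antidiagonal)
  then show ?thesis
    by (simp add: pfst_eq[abs_def])
qed

lemmas computable_pfst [computable_intros] = computable_comp[OF computable_pfst_fun]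

lemma computable_psnd_fun: "computable psnd"
proof -
  have "computable (\<lambda>z. antidiagonal z - pfst z)"
    by (intro computable_minus computable_antidiagonal computable_pfst_fun)
  then show ?thesis
    by (simp add: psnd_eq[abs_def])
qed

lemmas computable_psnd [computable_intros] = computable_comp[OF computable_psnd_fun]

text \<open>The counter, the previous value and the parameter are packed into one number, so the
  premise about the step function is again about a unary function and the same rules apply to
  it.\<close>

lemma computable_rec [computable_intros]:
  assumes "computable b" and "computable n"
    and "computable (\<lambda>z. g (pfst z) (pfst (psnd z)) (psnd (psnd z)))"
  shows "computable (\<lambda>x. rec_nat (b x) (\<lambda>y r. g y r x) (n x))"
proof -
  let ?G = "\<lambda>z. g (pfst z) (pfst (psnd z)) (psnd (psnd z))"
  have "recursive_fun 3 (\<lambda>xs. ?G (pair (xs ! 0) (pair (xs ! 1) (xs ! 2))))"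
    by (intro recursive_fun_op1[OF assms(3)] recursive_fun_op2[OF computable2_pair]
        recursive_fun_proj) simp_all
  then have "computable2 (\<lambda>n x. rec_nat (b x) (\<lambda>y r. g y r x) n)"
    by (intro computable2_iterate assms(1)) simp
  from computable_comp2[OF this assms(2) computable_id] show ?thesis .
qed

lemma computable_sum [computable_intros]:
  assumes "computable n" and "computable (\<lambda>z. F (pfst z) (psnd z))"
  shows "computable (\<lambda>x. \<Sum>y<n x. F y x)"
proof -
  \<comment> \<open>In the triple of counter, accumulator and parameter, the summand reads the first
    and the last entry only.\<close>
  have "computable (\<lambda>z. F (pfst z) (psnd (psnd z)))"
    using computable_comp[OF assms(2), of "\<lambda>z. pair (pfst z) (psnd (psnd z))"]
    by (simp add: computable_intros)
  then have "computable (\<lambda>x. rec_nat 0 (\<lambda>y r. r + F y x) (n x))"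
    by (intro computable_intros assms(1))
  moreover have "rec_nat 0 (\<lambda>y r. r + F y x) m = (\<Sum>y<m. F y x)" for m x
    by (induction m) auto
  ultimately show ?thesis
    by simp
qed

lemma computable_pow2 [computable_intros]:
  assumes "computable F"
  shows "computable (\<lambda>x. 2 ^ F x)"
proof -
  have "computable (\<lambda>x. rec_nat 1 (\<lambda>y r. 2 * r) (F x))"
    by (intro computable_intros assms)
  moreover have "rec_nat 1 (\<lambda>y r. 2 * r) n = (2 ^ n :: nat)" for n
    by (induction n) auto
  ultimately show ?thesis
    by simp
qed

section \<open>Decidable predicates\<close>

definition decidable :: "(nat \<Rightarrow> bool) \<Rightarrow> bool" where
  "decidable P \<longleftrightarrow> computable (\<lambda>x. of_bool (P x))"

lemma computable_of_bool [computable_intros]: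
  "decidable P \<Longrightarrow> computable (\<lambda>x. of_bool (P x))"
  by (simp add: decidable_def)

lemma decidable_comp: "decidable P \<Longrightarrow> computable F \<Longrightarrow> decidable (\<lambda>x. P (F x))"
  unfolding decidable_def by (rule computable_comp)

lemma decidable_not [computable_intros]:
  assumes "decidable P"
  shows "decidable (\<lambda>x. \<not> P x)"
proof -
  have "computable (\<lambda>x. 1 - of_bool (P x))"
    by (intro computable_intros assms)
  moreover have "of_bool (\<not> P x) = 1 - (of_bool (P x) :: nat)" for x
    by simp
  ultimately show ?thesis
    by (simp add: decidable_def)
qed

lemma decidable_conj [computable_intros]:
  assumes "decidable P" and "decidable Q"
  shows "decidable (\<lambda>x. P x \<and> Q x)"
  unfolding decidable_def of_bool_conj by (intro computable_intros assms)

lemma decidable_disj [computable_intros]: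
  assumes "decidable P" and "decidable Q"
  shows "decidable (\<lambda>x. P x \<or> Q x)"
proof -
  have "decidable (\<lambda>x. \<not> (\<not> P x \<and> \<not> Q x))"
    by (intro computable_intros assms)
  then show ?thesis
    by simp
qed

lemma decidable_le [computable_intros]:
  assumes "computable F" and "computable G"
  shows "decidable (\<lambda>x. F x \<le> G x)"
proof -
  have "computable (\<lambda>x. 1 - (F x - G x))"
    by (intro computable_intros assms)
  moreover have "of_bool (F x \<le> G x) = 1 - (F x - G x)" for x
    by simp
  ultimately show ?thesis
    by (simp add: decidable_def)
qed

lemma decidable_less [computable_intros]:
  assumes "computable F" and "computable G"
  shows "decidable (\<lambda>x. F x < G x)"
  unfolding less_eq_Suc_le by (intro computable_intros assms)

lemma decidable_eq [computable_intros]: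
  assumes "computable F" and "computable G"
  shows "decidable (\<lambda>x. F x = G x)"
  unfolding order_eq_iff by (intro computable_intros assms)

text \<open>The sum of the indicators counts the witnesses below the bound, so existence is
  positivity of a computable number.\<close>

lemma decidable_bex [computable_intros]:
  assumes "computable n" and "decidable (\<lambda>z. P (pfst z) (psnd z))"
  shows "decidable (\<lambda>x. \<exists>y<n x. P y x)"
proof -
  have "decidable (\<lambda>x. 0 < (\<Sum>y<n x. of_bool (P y x) :: nat))"
    by (intro computable_intros assms)
  moreover have "0 < (\<Sum>y<n x. of_bool (P y x) :: nat) \<longleftrightarrow> (\<exists>y<n x. P y x)" for x
    by (auto simp: zero_less_iff_neq_zero)
  ultimately show ?thesis
    by simp
qed

lemma computable_if [computable_intros]:
  assumes "decidable P" and "computable F" and "computable G"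
  shows "computable (\<lambda>x. if P x then F x else G x)"
proof -
  have "computable (\<lambda>x. of_bool (P x) * F x + of_bool (\<not> P x) * G x)"
    by (intro computable_intros assms)
  moreover have "(if P x then F x else G x) = of_bool (P x) * F x + of_bool (\<not> P x) * G x" for x
    by simp
  ultimately show ?thesis
    by simp
qed

text \<open>Bit \<open>n\<close> of \<open>s\<close> is set iff the quotient by \<open>2 ^ n\<close>
  is odd. Writing out quotient and remainder with bounded quantifiers reduces the bit test to
  operations already known to be computable.\<close>

lemma set_decode_iff: "n \<in> set_decode s \<longleftrightarrow> (\<exists>q<Suc s. \<exists>r<2 ^ n. s = (2 * q + 1) * 2 ^ n + r)"
proof
  assume "n \<in> set_decode s"
  then obtain q where q: "s div 2 ^ n = 2 * q + 1"
    by (auto simp: set_decode_def elim: oddE)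
  then have "s = (2 * q + 1) * 2 ^ n + s mod 2 ^ n"
    by (metis div_mult_mod_eq)
  moreover have "q < Suc s"
    using q div_le_dividend[of s "2 ^ n"] by linarith
  ultimately show "\<exists>q<Suc s. \<exists>r<2 ^ n. s = (2 * q + 1) * 2 ^ n + r"
    by (meson mod_less_divisor zero_less_numeral zero_less_power)
next
  assume "\<exists>q<Suc s. \<exists>r<2 ^ n. s = (2 * q + 1) * 2 ^ n + r"
  then obtain q r where "r < 2 ^ n" "s = (2 * q + 1) * 2 ^ n + r"
    by blast
  then have "s div 2 ^ n = 2 * q + 1"
    by (metis add.commute add_cancel_right_left div_less div_mult_self3 less_zeroE mult.commute power_eq_0_iff)
  then show "n \<in> set_decode s"
    by (simp add: set_decode_def)
qed

lemma decidable_set_decode [computable_intros]: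
  assumes "computable F" and "computable G"
  shows "decidable (\<lambda>x. F x \<in> set_decode (G x))"
proof -
  have "decidable (\<lambda>z. \<exists>q<Suc (psnd z). \<exists>r<2 ^ pfst z. psnd z = (2 * q + 1) * 2 ^ pfst z + r)"
    by (intro computable_intros)
  from decidable_comp[OF this, of "\<lambda>x. pair (F x) (G x)"] show ?thesis
    by (simp add: set_decode_iff computable_intros assms)
qed

text \<open>A set bit \<open>n\<close> forces \<open>2 ^ n \<le> s\<close>. Hence quantifiers over a
  coded set may be bounded by its code, which keeps \<open>derived\<close> decidable.\<close>

lemma set_decode_less: "n \<in> set_decode s \<Longrightarrow> n < s"
  by (metis div_less even_zero leI mem_Collect_eq order.strict_trans2 set_decode_def less_exp)

section \<open>Unbounded search\<close>

definition partial_computable :: "(nat \<Rightarrow> nat option) \<Rightarrow> bool" where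
  "partial_computable p \<longleftrightarrow> (\<exists>g. partial_recursive 1 g \<and> (\<forall>x. g [x] = p x))"

lemma partial_computable_search:
  assumes "decidable (\<lambda>z. P (pfst z) (psnd z))"
  shows "partial_computable (\<lambda>x. if \<exists>y. P y x then Some (LEAST y. P y x) else None)"
proof -
  \<comment> \<open>\<open>pr_min\<close> looks for a zero, so the indicator of the negation is
    searched; as it is total, the definedness condition on earlier values holds
    automatically.\<close>
  have "computable (\<lambda>z. of_bool (\<not> P (pfst z) (psnd z)))"
    by (intro computable_intros assms)
  from recursive_fun_op1[OF this recursive_fun_op2[OF computable2_pair], of 2 "\<lambda>xs. xs ! 0" "\<lambda>xs. xs ! 1"]
  have "recursive_fun 2 (\<lambda>xs. of_bool (\<not> P (xs ! 0) (xs ! 1)))"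
    by (simp add: recursive_fun_proj del: of_bool_not_iff)
  then obtain f where f: "partial_recursive 2 f" "\<And>x y. f [y, x] = Some (of_bool (\<not> P y x))"
    by (auto simp: recursive_fun_def simp del: of_bool_not_iff)
  have "pr_min f [x] = (if \<exists>y. P y x then Some (LEAST y. P y x) else None)" for x
    by (auto simp: pr_min_def f(2))
  moreover have "partial_recursive 1 (pr_min f)"
    using f(1) by (intro partial_recursive.minim) (simp add: numeral_2_eq_2)
  ultimately show ?thesis
    unfolding partial_computable_def by blast
qed

lemma computable_iff_partial: "computable F \<longleftrightarrow> partial_computable (\<lambda>x. Some (F x))"
proof -
  have "(\<forall>xs. length xs = Suc 0 \<longrightarrow> g xs = Some (F (xs ! 0))) \<longleftrightarrow> (\<forall>x. g [x] = Some (F x))" for g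
    by (auto simp: length_Suc_conv)
  then show ?thesis
    by (simp add: computable_def recursive_fun_def partial_computable_def)
qed

lemma computable_Least [computable_intros]:
  assumes "decidable (\<lambda>z. P (pfst z) (psnd z))" and "\<And>x. \<exists>y. P y x"
  shows "computable (\<lambda>x. LEAST y. P y x)"
  using partial_computable_search[OF assms(1)] assms(2) by (simp add: computable_iff_partial)

section \<open>An enumeration of the partial recursive functions\<close>

text \<open>
  \<open>eval e x y\<close> says that the function with code \<open>e\<close> maps \<open>x\<close> to \<open>y\<close>. All functions are unary;
  the argument list \<open>[x1, ..., xn]\<close> becomes \<open>pair x1 (... (pair xn 0))\<close>. The code with tag 7 maps
  \<open>pair n u\<close> to the first zero from \<open>n\<close> on; the second component of such a code is irrelevant.
\<close>

inductive eval :: "nat \<Rightarrow> nat \<Rightarrow> nat \<Rightarrow> bool" where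
  zero: "eval (pair 0 c) x 0"
| succ: "eval (pair 1 c) x (Suc x)"
| first: "eval (pair 2 c) x (pfst x)"
| second: "eval (pair 3 c) x (psnd x)"
| pairing: "eval a x y \<Longrightarrow> eval b x z \<Longrightarrow> eval (pair 4 (pair a b)) x (pair y z)"
| comp: "eval b x u \<Longrightarrow> eval a u y \<Longrightarrow> eval (pair 5 (pair a b)) x y"
| rec_0: "eval a u y \<Longrightarrow> eval (pair 6 (pair a b)) (pair 0 u) y"
| rec_Suc: "eval (pair 6 (pair a b)) (pair n u) r \<Longrightarrow> eval b (pair n (pair r u)) y \<Longrightarrow>
    eval (pair 6 (pair a b)) (pair (Suc n) u) y"
| found: "eval a (pair n u) 0 \<Longrightarrow> eval (pair 7 (pair a b)) (pair n u) n"
| skip: "eval a (pair n u) (Suc r) \<Longrightarrow> eval (pair 7 (pair a b)) (pair (Suc n) u) y \<Longrightarrow>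
    eval (pair 7 (pair a b)) (pair n u) y"

text \<open>
  A judgement \<open>eval e x y\<close> is the number \<open>pair e (pair x y)\<close>. Every rule has at most two premises,
  so the set of derivable judgements is the union of the finite sets of those derived by stage \<open>t\<close>.
  Coding these sets as bit masks makes \<open>stage\<close> primitive recursive; this replaces Kleene's
  normal form theorem.
\<close>

definition axiom_triple :: "nat \<Rightarrow> bool" where
  "axiom_triple z \<longleftrightarrow>
     (let k = pfst (pfst z); x = pfst (psnd z); y = psnd (psnd z)
      in k = 0 \<and> y = 0 \<or> k = 1 \<and> y = Suc x \<or> k = 2 \<and> y = pfst x \<or> k = 3 \<and> y = psnd x)"

text \<open>The intermediate value \<open>r\<close> of a two-premise rule is read off the first
  premise instead of being quantified, so the test is plain arithmetic. Rules with one premise leave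
  \<open>q\<close> free.\<close>

definition follows :: "nat \<Rightarrow> nat \<Rightarrow> nat \<Rightarrow> bool" where
  "follows z p q \<longleftrightarrow>
     (let e = pfst z; k = pfst e; a = pfst (psnd e); b = psnd (psnd e);
          x = pfst (psnd z); y = psnd (psnd z); n = pfst x; u = psnd x; r = psnd (psnd p)
      in k = 4 \<and> p = pair a (pair x (pfst y)) \<and> q = pair b (pair x (psnd y)) \<or>
         k = 5 \<and> p = pair b (pair x r) \<and> q = pair a (pair r y) \<or>
         k = 6 \<and> n = 0 \<and> p = pair a (pair u y) \<or>
         k = 6 \<and> 0 < n \<and> p = pair e (pair (pair (n - 1) u) r) \<and>
           q = pair b (pair (pair (n - 1) (pair r u)) y) \<or>
         k = 7 \<and> p = pair a (pair x 0) \<and> y = n \<or>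
         k = 7 \<and> 0 < r \<and> p = pair a (pair x r) \<and> q = pair e (pair (pair (Suc n) u) y))"

definition derived :: "nat \<Rightarrow> nat \<Rightarrow> bool" where
  "derived z s \<longleftrightarrow> axiom_triple z \<or>
     (\<exists>p<s. \<exists>q<s. p \<in> set_decode s \<and> q \<in> set_decode s \<and> follows z p q)"

definition stage :: "nat \<Rightarrow> nat" where
  "stage = rec_nat 0 (\<lambda>t s. \<Sum>z<Suc t. if derived z s then 2 ^ z else 0)"

lemma decidable_derived [computable_intros]:
  assumes "computable F" and "computable G"
  shows "decidable (\<lambda>x. derived (F x) (G x))"
proof -
  have "decidable (\<lambda>z. derived (pfst z) (psnd z))"
    unfolding derived_def axiom_triple_def follows_def Let_def by (intro computable_intros)
  from decidable_comp[OF this, of "\<lambda>x. pair (F x) (G x)"] show ?thesis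
    by (simp add: computable_intros assms)
qed

lemma computable_stage: "computable stage"
proof -
  have "computable (\<lambda>x. rec_nat 0 (\<lambda>t s. \<Sum>z<Suc t. if derived z s then 2 ^ z else 0) x)"
    by (intro computable_intros)
  then show ?thesis
    by (simp add: stage_def)
qed

lemma set_decode_stage_0 [simp]: "set_decode (stage 0) = {}"
  by (simp add: stage_def)

lemma set_decode_stage_Suc [simp]: "set_decode (stage (Suc t)) = {z. z < Suc t \<and> derived z (stage t)}"
proof -
  have "stage (Suc t) = (\<Sum>z<Suc t. if derived z (stage t) then 2 ^ z else 0)"
    by (simp add: stage_def)
  also have "\<dots> = set_encode {z \<in> {..<Suc t}. derived z (stage t)}"
    unfolding set_encode_def by (rule sum.inter_filter[symmetric]) simp
  finally show ?thesis
    by (simp add: set_encode_inverse)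
qed

lemma derived_iff:
  "derived z s \<longleftrightarrow> axiom_triple z \<or> (\<exists>p\<in>set_decode s. \<exists>q\<in>set_decode s. follows z p q)"
  unfolding derived_def using set_decode_less by blast

text \<open>Each stage is recomputed from the previous one rather than added to it. It still grows,
  because \<open>derived\<close> is monotone in the coded set and the cut-off on \<open>z\<close>
  only rises.\<close>

lemma stage_mono_Suc: "set_decode (stage t) \<subseteq> set_decode (stage (Suc t))"
proof (induction t)
  case (Suc t)
  show ?case
  proof
    fix z assume "z \<in> set_decode (stage (Suc t))"
    then have "z < Suc t" "derived z (stage t)"
      by simp_all
    moreover from this Suc have "derived z (stage (Suc t))"
      unfolding derived_iff by blast
    ultimately show "z \<in> set_decode (stage (Suc (Suc t)))"
      by simp
  qed
qed simp

lemma stage_mono: "t \<le> t' \<Longrightarrow> set_decode (stage t) \<subseteq> set_decode (stage t')"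
  by (rule lift_Suc_mono_le[of "\<lambda>t. set_decode (stage t)"]) (rule stage_mono_Suc)

lemma eval_of_stage:
  "z \<in> set_decode (stage t) \<Longrightarrow> eval (pfst z) (pfst (psnd z)) (psnd (psnd z))"
proof (induction t arbitrary: z)
  case (Suc t)
  obtain k a b x y where z: "z = pair (pair k (pair a b)) (pair x y)"
    by (metis pair_collapse)
  from Suc.prems have "derived z (stage t)"
    by simp
  then consider "axiom_triple z"
    | p q where "p \<in> set_decode (stage t)" "q \<in> set_decode (stage t)" "follows z p q"
    unfolding derived_iff by blast
  then show ?case
  proof cases
    case 1
    then show ?thesis
      using eval.zero eval.succ eval.first eval.second by (auto simp: axiom_triple_def z Let_def)
  next
    case 2
    note p = Suc.IH[OF 2(1)] and q = Suc.IH[OF 2(2)]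
    obtain n u where x: "x = pair n u"
      by (metis pair_collapse)
    \<comment> \<open>The predecessor \<open>n - 1\<close> and the condition \<open>0 < r\<close>
      are replaced by successors, so that every case has the shape of a rule of
      \<open>eval\<close>.\<close>
    from 2(3) consider
      (pairing) "k = 4" "p = pair a (pair x (pfst y))" "q = pair b (pair x (psnd y))"
      | (comp) r where "k = 5" "p = pair b (pair x r)" "q = pair a (pair r y)"
      | (rec_0) "k = 6" "n = 0" "p = pair a (pair u y)"
      | (rec_Suc) m r where "k = 6" "n = Suc m" "p = pair (pair k (pair a b)) (pair (pair m u) r)"
          "q = pair b (pair (pair m (pair r u)) y)"
      | (found) "k = 7" "p = pair a (pair x 0)" "y = n"
      | (skip) r where "k = 7" "p = pair a (pair x (Suc r))"
          "q = pair (pair k (pair a b)) (pair (pair (Suc n) u) y)"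
      unfolding follows_def Let_def z x
      by (simp only: pfst_pair psnd_pair) (metis Suc_pred gr0_conv_Suc diff_Suc_1)
    then show ?thesis
    proof cases
      case pairing
      \<comment> \<open>The rule concludes with a literal pair, so \<open>y\<close> is rebuilt from
        its two components.\<close>
      then show ?thesis
        using p q eval.pairing[of a x "pfst y" b "psnd y"] by (simp add: z)
    qed (use p q in \<open>auto simp: z x intro: eval.intros\<close>)
  qed
qed simp

lemma stage_axiom: "axiom_triple z \<Longrightarrow> \<exists>t. z \<in> set_decode (stage t)"
  by (rule exI[of _ "Suc z"]) (simp add: derived_def)

lemma stage_follows:
  assumes "\<exists>t. p \<in> set_decode (stage t)" and "\<exists>t. q \<in> set_decode (stage t)" and "follows z p q"
  shows "\<exists>t. z \<in> set_decode (stage t)"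
proof -
  obtain t t' where t: "p \<in> set_decode (stage t)" "q \<in> set_decode (stage t')"
    using assms by blast
  \<comment> \<open>From \<open>t\<close> and \<open>t'\<close> on both premises are present; from
    \<open>z\<close> on the cut-off of stage \<open>Suc m\<close> admits the conclusion.\<close>
  define m where "m = max z (max t t')"
  have "t \<le> m" "t' \<le> m"
    by (simp_all add: m_def)
  then have "p \<in> set_decode (stage m)" "q \<in> set_decode (stage m)"
    using t stage_mono by blast+
  then have "derived z (stage m)"
    using assms(3) unfolding derived_iff by blast
  then have "z \<in> set_decode (stage (Suc m))"
    by (simp add: m_def less_Suc_eq_le)
  then show ?thesis ..
qed

lemma stage_of_eval: "eval e x y \<Longrightarrow> \<exists>t. pair e (pair x y) \<in> set_decode (stage t)"
proof (induction rule: eval.induct)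
  case pairing
  show ?case
    by (rule stage_follows[OF pairing.IH]) (simp add: follows_def)
next
  case comp
  show ?case
    by (rule stage_follows[OF comp.IH]) (simp add: follows_def)
next
  case rec_0
  \<comment> \<open>The single premise is supplied for both \<open>p\<close> and
    \<open>q\<close>.\<close>
  show ?case
    by (rule stage_follows[OF rec_0.IH rec_0.IH]) (simp add: follows_def)
next
  case rec_Suc
  show ?case
    by (rule stage_follows[OF rec_Suc.IH]) (simp add: follows_def)
next
  case found
  show ?case
    by (rule stage_follows[OF found.IH found.IH]) (simp add: follows_def)
next
  case skip
  show ?case
    by (rule stage_follows[OF skip.IH]) (simp add: follows_def)
qed (rule stage_axiom, simp add: axiom_triple_def)+

theorem eval_iff_stage: "eval e x y \<longleftrightarrow> (\<exists>t. pair e (pair x y) \<in> set_decode (stage t))"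
  using stage_of_eval eval_of_stage by fastforce

section \<open>Every partial recursive function has a code\<close>

fun encode :: "nat list \<Rightarrow> nat" where
  "encode [] = 0"
| "encode (x # xs) = pair x (encode xs)"

text \<open>Being an equivalence for all \<open>y\<close>, it also forces the code to diverge
  wherever \<open>f\<close> is undefined.\<close>

definition represents :: "nat \<Rightarrow> nat \<Rightarrow> (nat list \<Rightarrow> nat option) \<Rightarrow> bool" where
  "represents c n f \<longleftrightarrow> (\<forall>xs y. length xs = n \<longrightarrow> (eval c (encode xs) y \<longleftrightarrow> f xs = Some y))"

inductive_cases eval_zeroE: "eval (pair 0 c) x y"
inductive_cases eval_succE: "eval (pair 1 c) x y"
inductive_cases eval_firstE: "eval (pair 2 c) x y"
inductive_cases eval_secondE: "eval (pair 3 c) x y"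
inductive_cases eval_pairingE: "eval (pair 4 c) x y"
inductive_cases eval_compE: "eval (pair 5 (pair a b)) x y"
inductive_cases eval_recE: "eval (pair 6 (pair a b)) (pair n u) y"

lemma eval_zero_iff [simp]: "eval (pair 0 c) x y \<longleftrightarrow> y = 0"
  by (auto elim: eval_zeroE intro: eval.zero)

lemma eval_succ_iff [simp]: "eval (pair (Suc 0) c) x y \<longleftrightarrow> y = Suc x"
  using eval.succ by (auto elim: eval_succE[simplified])

lemma eval_first_iff [simp]: "eval (pair 2 c) x y \<longleftrightarrow> y = pfst x"
  by (auto elim: eval_firstE intro: eval.first)

lemma eval_second_iff [simp]: "eval (pair 3 c) x y \<longleftrightarrow> y = psnd x"
  by (auto elim: eval_secondE intro: eval.second)

lemma eval_pairing_iff [simp]: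
  "eval (pair 4 (pair a b)) x y \<longleftrightarrow> eval a x (pfst y) \<and> eval b x (psnd y)"
proof
  assume "eval a x (pfst y) \<and> eval b x (psnd y)"
  then have "eval (pair 4 (pair a b)) x (pair (pfst y) (psnd y))"
    by (blast intro: eval.pairing)
  then show "eval (pair 4 (pair a b)) x y"
    by simp
qed (auto elim: eval_pairingE)

lemma eval_comp_iff [simp]:
  "eval (pair 5 (pair a b)) x y \<longleftrightarrow> (\<exists>u. eval b x u \<and> eval a u y)"
  by (auto elim: eval_compE intro: eval.comp)

text \<open>No tag stands for the identity, so it is the pairing of the two projections.
  Minimisation uses it to keep the arguments while prepending a start value.\<close>

lemma eval_id_iff: "eval (pair 4 (pair (pair 2 0) (pair 3 0))) x y \<longleftrightarrow> y = x"
  by simp (metis pair_collapse)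

lemma eval_rec_0_iff: "eval (pair 6 (pair a b)) (pair 0 u) y \<longleftrightarrow> eval a u y"
  by (auto elim: eval_recE intro: eval.rec_0)

lemma eval_rec_Suc_iff:
  "eval (pair 6 (pair a b)) (pair (Suc n) u) y \<longleftrightarrow>
     (\<exists>r. eval (pair 6 (pair a b)) (pair n u) r \<and> eval b (pair n (pair r u)) y)"
  by (auto elim: eval_recE intro: eval.rec_Suc)

text \<open>The start of the search moves along a derivation, so \<open>n\<close> must be arbitrary:
  rule induction generalises it in one direction, and the other descends from the result
  \<open>y\<close> down to \<open>n\<close>.\<close>

lemma eval_min_iff:
  "eval (pair 7 (pair a b)) (pair n u) y \<longleftrightarrow>
     n \<le> y \<and> eval a (pair y u) 0 \<and> (\<forall>m\<in>{n..<y}. \<exists>r. eval a (pair m u) (Suc r))"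
  (is "?L \<longleftrightarrow> ?R n")
proof
  have "eval e x y \<Longrightarrow> e = pair 7 (pair a b) \<Longrightarrow> x = pair n u \<Longrightarrow> ?R n" for e x n
  proof (induction arbitrary: n rule: eval.induct)
    case (skip a' n' u' r b' y)
    then have "Suc n \<le> y" "eval a (pair y u) 0"
      "\<forall>m\<in>{Suc n..<y}. \<exists>r. eval a (pair m u) (Suc r)" "eval a (pair n u) (Suc r)"
      by auto
    moreover have "{n..<y} = insert n {Suc n..<y}"
      using \<open>Suc n \<le> y\<close> by auto
    ultimately show ?case
      by auto
  qed auto
  then show "?L \<Longrightarrow> ?R n"
    by blast
next
  assume R: "?R n"
  then have "n \<le> y"
    by blast
  then show ?L
    using R
  proof (induction rule: inc_induct)
    case base
    then show ?case
      by (auto intro: eval.found)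
  next
    case (step m)
    have "m \<in> {m..<y}"
      using step.hyps by simp
    then obtain r where "eval a (pair m u) (Suc r)"
      using step.prems by blast
    then show ?case
      by (rule eval.skip) (use step in auto)
  qed
qed

lemma represents_proj: "\<exists>c. represents c n (\<lambda>xs. Some (xs ! i))" if "i < n"
proof -
  \<comment> \<open>One code must serve all sufficiently long lists, so that the induction on
    \<open>i\<close> can pass to the tail.\<close>
  have "\<exists>c. \<forall>xs y. i < length xs \<longrightarrow> (eval c (encode xs) y \<longleftrightarrow> y = xs ! i)"
  proof (induction i)
    case 0
    have "eval (pair 2 0) (encode xs) y \<longleftrightarrow> y = xs ! 0" if "0 < length xs" for xs y
      using that by (cases xs) auto
    then show ?case
      by blast
  next
    case (Suc i)
    then obtain c where c: "\<And>xs y. i < length xs \<Longrightarrow> eval c (encode xs) y \<longleftrightarrow> y = xs ! i"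
      by blast
    have "eval (pair 5 (pair c (pair 3 0))) (encode xs) y \<longleftrightarrow> y = xs ! Suc i"
      if "Suc i < length xs" for xs y
      using that by (cases xs) (auto simp: c)
    then show ?case
      by blast
  qed
  then show ?thesis
    using that by (force simp: represents_def)
qed

text \<open>A code takes a single input, so the inner functions of a composition are bundled into
  one code for the whole list. Pairing diverges as soon as one component does, just like
  \<open>pr_comp\<close>.\<close>

lemma represents_tuple:
  assumes "\<And>g. g \<in> set gs \<Longrightarrow> \<exists>c. represents c n g"
  shows "\<exists>c. \<forall>xs y. length xs = n \<longrightarrow>
           (eval c (encode xs) y \<longleftrightarrow>
              (\<forall>g\<in>set gs. g xs \<noteq> None) \<and> y = encode (map (\<lambda>g. the (g xs)) gs))"
  using assms
proof (induction gs)
  case Nil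
  show ?case
    by (rule exI[of _ "pair 0 0"]) simp
next
  case (Cons g gs)
  then obtain c d where c: "represents c n g"
    and d: "\<And>xs y. length xs = n \<Longrightarrow> eval d (encode xs) y \<longleftrightarrow>
              (\<forall>g\<in>set gs. g xs \<noteq> None) \<and> y = encode (map (\<lambda>g. the (g xs)) gs)"
    by (metis list.set_intros)
  have "eval (pair 4 (pair c d)) (encode xs) y \<longleftrightarrow>
          (\<forall>g\<in>set (g # gs). g xs \<noteq> None) \<and> y = encode (map (\<lambda>g. the (g xs)) (g # gs))"
    if "length xs = n" for xs y
    using that c by (auto simp: d represents_def eq_pair_iff)
  then show ?case
    by blast
qed

theorem represents_partial_recursive: "partial_recursive n f \<Longrightarrow> \<exists>c. represents c n f"
proof (induction rule: partial_recursive.induct)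
  case (zero n)
  show ?case
    by (rule exI[of _ "pair 0 0"]) (auto simp: represents_def)
next
  case succ
  \<comment> \<open>A unary argument arrives as \<open>pair x 0\<close>, hence the first projection
    before the successor.\<close>
  have "represents (pair 5 (pair (pair 1 0) (pair 2 0))) 1 (\<lambda>xs. Some (Suc (xs ! 0)))"
    by (auto simp: represents_def length_Suc_conv)
  then show ?case ..
next
  case (proj i n)
  then show ?case
    by (rule represents_proj)
next
  case (comp gs f n)
  then obtain c d where c: "represents c (length gs) f"
    and d: "\<And>xs y. length xs = n \<Longrightarrow> eval d (encode xs) y \<longleftrightarrow>
              (\<forall>g\<in>set gs. g xs \<noteq> None) \<and> y = encode (map (\<lambda>g. the (g xs)) gs)"
    using represents_tuple[of gs n] by metis
  have "represents (pair 5 (pair c d)) n (pr_comp f gs)"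
    using c by (auto simp: represents_def d pr_comp_def)
  then show ?case ..
next
  case (prim_rec n f g)
  then obtain a b where a: "represents a n f" and b: "represents b (Suc (Suc n)) g"
    by blast
  have "eval (pair 6 (pair a b)) (pair m (encode xs)) y \<longleftrightarrow> pr_rec f g m xs = Some y"
    if "length xs = n" for m xs y
  proof (induction m arbitrary: y)
    case 0
    then show ?case
      using a that by (simp add: eval_rec_0_iff represents_def)
  next
    case (Suc m)
    have "eval b (pair m (pair r (encode xs))) y \<longleftrightarrow> g (m # r # xs) = Some y" for r
      using b that unfolding represents_def by (metis encode.simps(2) length_Cons)
    then show ?case
      by (auto simp: eval_rec_Suc_iff Suc.IH split: option.split)
  qed
  then have "represents (pair 6 (pair a b)) (Suc n) (\<lambda>xs. pr_rec f g (hd xs) (tl xs))"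
    by (auto simp: represents_def length_Suc_conv)
  then show ?case ..
next
  case (minim n f)
  then obtain a where a: "represents a (Suc n) f"
    by blast
  \<comment> \<open>The inner code maps \<open>x\<close> to \<open>pair 0 x\<close>, so that the
    search starts at 0.\<close>
  let ?c = "pair 5 (pair (pair 7 (pair a 0)) (pair 4 (pair (pair 0 0) (pair 4 (pair (pair 2 0) (pair 3 0))))))"
  have "eval ?c (encode xs) y \<longleftrightarrow> pr_min f xs = Some y" if "length xs = n" for xs y
  proof -
    have f: "eval a (pair m (encode xs)) r \<longleftrightarrow> f (m # xs) = Some r" for m r
      using a that unfolding represents_def by (metis encode.simps(2) length_Cons)
    have "eval (pair 4 (pair (pair 0 0) (pair 4 (pair (pair 2 0) (pair 3 0))))) x u \<longleftrightarrow> u = pair 0 x" for x u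
      unfolding eval_pairing_iff[of "pair 0 0"] eval_id_iff by (simp add: eq_pair_iff)
    then have "eval ?c (encode xs) y \<longleftrightarrow> eval (pair 7 (pair a 0)) (pair 0 (encode xs)) y"
      unfolding eval_comp_iff by simp
    also have "\<dots> \<longleftrightarrow> f (y # xs) = Some 0 \<and> (\<forall>m<y. \<exists>r. f (m # xs) = Some (Suc r))"
      by (auto simp: eval_min_iff f)
    also have "\<dots> \<longleftrightarrow> pr_min f xs = Some y"
    proof
      assume L: "f (y # xs) = Some 0 \<and> (\<forall>m<y. \<exists>r. f (m # xs) = Some (Suc r))"
      then have "(LEAST y. f (y # xs) = Some 0) = y"
        by (intro Least_equality) (auto simp: not_less[symmetric])
      moreover have "\<exists>y. f (y # xs) = Some 0 \<and> (\<forall>z<y. f (z # xs) \<noteq> None)"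
        using L by (intro exI[of _ y]) fastforce
      ultimately show "pr_min f xs = Some y"
        unfolding pr_min_def by simp
    next
      assume "pr_min f xs = Some y"
      then obtain z where z: "f (z # xs) = Some 0" "\<And>m. m < z \<Longrightarrow> f (m # xs) \<noteq> None"
        and y: "y = (LEAST y. f (y # xs) = Some 0)"
        by (auto simp: pr_min_def split: if_splits)
      \<comment> \<open>Minimality of \<open>y\<close> excludes the value 0 at \<open>m\<close>, and
        \<open>y \<le> z\<close> excludes divergence; only a successor remains.\<close>
      have "\<exists>r. f (m # xs) = Some (Suc r)" if "m < y" for m
      proof -
        have "f (m # xs) \<noteq> Some 0"
          using that not_less_Least unfolding y by blast
        moreover have "m < z"
          using that z(1) unfolding y by (meson Least_le less_le_trans)
        ultimately show ?thesis
          using z(2)[of m] by (metis not0_implies_Suc option.exhaust)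
      qed
      moreover have "f (y # xs) = Some 0"
        unfolding y using z(1) by (rule LeastI)
      ultimately show "f (y # xs) = Some 0 \<and> (\<forall>m<y. \<exists>r. f (m # xs) = Some (Suc r))"
        by blast
    qed
    finally show ?thesis .
  qed
  then have "represents ?c n (pr_min f)"
    by (simp add: represents_def)
  then show ?case ..
qed

section \<open>Semidecidable sets\<close>

definition semidecidable :: "nat set \<Rightarrow> bool" where
  "semidecidable S \<longleftrightarrow> (\<exists>P. decidable P \<and> S = {n. \<exists>t. P (pair t n)})"

lemma partial_computable_code:
  assumes "partial_computable p"
  obtains c where "\<And>x y. eval c (pair x 0) y \<longleftrightarrow> p x = Some y"
proof -
  obtain g where g: "partial_recursive 1 g" "\<And>x. g [x] = p x"
    using assms by (auto simp: partial_computable_def)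
  then obtain c where "represents c 1 g"
    using represents_partial_recursive by blast
  then have "eval c (encode [x]) y \<longleftrightarrow> g [x] = Some y" for x y
    unfolding represents_def by (metis length_Cons list.size(3) One_nat_def)
  then show thesis
    using g(2) by (intro that[of c]) simp
qed

lemma semidecidable_dom:
  assumes "partial_computable p"
  shows "semidecidable (dom p)"
proof -
  obtain c where c: "\<And>x y. eval c (pair x 0) y \<longleftrightarrow> p x = Some y"
    using partial_computable_code[OF assms] by blast
  \<comment> \<open>The witness packs a stage together with an output value.\<close>
  let ?P = "\<lambda>z. pair c (pair (pair (psnd z) 0) (psnd (pfst z))) \<in> set_decode (stage (pfst (pfst z)))"
  have "decidable ?P"
    by (intro computable_intros computable_comp[OF computable_stage])
  moreover have "n \<in> dom p \<longleftrightarrow> (\<exists>t. ?P (pair t n))" for n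
  proof -
    have "n \<in> dom p \<longleftrightarrow> (\<exists>y t. ?P (pair (pair t y) n))"
      by (simp add: domIff not_None_eq flip: c eval_iff_stage)
    also have "\<dots> \<longleftrightarrow> (\<exists>t. ?P (pair t n))"
      by (metis pair_collapse)
    finally show ?thesis .
  qed
  ultimately show ?thesis
    unfolding semidecidable_def by blast
qed

lemma semidecidable_obtain_dom:
  assumes "semidecidable S"
  obtains p where "partial_computable p" and "dom p = S"
proof -
  obtain P where P: "decidable P" "S = {n. \<exists>t. P (pair t n)}"
    using assms by (auto simp: semidecidable_def)
  have "partial_computable (\<lambda>n. if \<exists>t. P (pair t n) then Some (LEAST t. P (pair t n)) else None)"
    by (rule partial_computable_search) (simp add: P(1))
  then show thesis
    by (rule that) (auto simp: P(2) dom_def)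
qed

lemma decidable_imp_semidecidable:
  assumes "decidable P"
  shows "semidecidable {n. P n}"
proof -
  have "decidable (\<lambda>z. P (psnd z))"
    by (intro decidable_comp[OF assms] computable_intros)
  moreover have "{n. P n} = {n. \<exists>t. P (psnd (pair t n))}"
    by simp
  ultimately show ?thesis
    unfolding semidecidable_def by blast
qed

section \<open>Injective enumerations of infinite sets\<close>

definition rank :: "(nat \<Rightarrow> bool) \<Rightarrow> nat \<Rightarrow> nat" where
  "rank P n = (\<Sum>i<n. of_bool (P i))"

lemma computable_rank: "decidable P \<Longrightarrow> computable (rank P)"
  unfolding rank_def by (intro computable_intros) (rule decidable_comp[OF _ computable_pfst_fun])

lemma rank_mono: "m \<le> n \<Longrightarrow> rank P m \<le> rank P n"
  by (rule lift_Suc_mono_le[of "rank P"]) (auto simp: rank_def)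

text \<open>Passing a member raises the count by exactly one and nothing else changes it, so
  distinct members differ in rank. Infinity always supplies a next member, so no rank is
  skipped.\<close>

lemma bij_betw_rank:
  assumes "infinite {n. P n}"
  shows "bij_betw (rank P) {n. P n} UNIV"
proof (rule bij_betw_imageI)
  have "rank P m < rank P n" if "P m" "m < n" for m n
  proof -
    have "rank P m < rank P (Suc m)"
      using that(1) by (simp add: rank_def)
    also have "\<dots> \<le> rank P n"
      using that(2) by (intro rank_mono) simp
    finally show ?thesis .
  qed
  then show "inj_on (rank P) {n. P n}"
    by (intro linorder_inj_onI) (auto simp: less_imp_neq)
  have "\<exists>n. P n \<and> rank P n = r" for r
  proof (induction r)
    case 0
    from assms obtain n where "P n"
      using infinite_imp_nonempty by blast
    define m where "m = (LEAST n. P n)"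
    have "P m" "\<And>i. i < m \<Longrightarrow> \<not> P i"
      unfolding m_def using \<open>P n\<close> by (auto intro: LeastI dest: not_less_Least)
    then show ?case
      by (auto simp: rank_def)
  next
    case (Suc r)
    then obtain n where n: "P n" "rank P n = r"
      by blast
    obtain n' where "n < n'" "P n'"
      using assms unfolding infinite_nat_iff_unbounded by blast
    define m where "m = (LEAST i. n < i \<and> P i)"
    have m: "n < m" "P m" "\<And>i. i < m \<Longrightarrow> \<not> (n < i \<and> P i)"
      unfolding m_def using LeastI[of "\<lambda>i. n < i \<and> P i" n'] \<open>n < n'\<close> \<open>P n'\<close> not_less_Least by blast+
    have "rank P i = Suc r" if "n < i" "i \<le> m" for i
      using that
    proof (induction i)
      case (Suc i)
      then show ?case
        using n m(3)[of i] by (cases "i = n") (auto simp: rank_def)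
    qed simp
    then show ?case
      using m by blast
  qed
  then show "rank P ` {n. P n} = UNIV"
    by (auto simp: image_def) metis
qed

text \<open>The enumeration is the inverse of \<open>rank\<close>, found by a search that always
  stops because every rank is attained.\<close>

lemma decidable_enumeration:
  assumes "decidable P" and "infinite {n. P n}"
  obtains k where "computable k" and "bij_betw k UNIV {n. P n}"
proof -
  have bij: "bij_betw (rank P) {n. P n} UNIV"
    using assms(2) by (rule bij_betw_rank)
  define k where "k m = (LEAST n. P n \<and> rank P n = m)" for m
  have ex: "\<exists>n. P n \<and> rank P n = m" for m
    using bij_betw_imp_surj_on[OF bij] by (metis (no_types, lifting) UNIV_I imageE mem_Collect_eq)
  have "decidable (\<lambda>z. P (pfst z) \<and> rank P (pfst z) = psnd z)"
    by (intro computable_intros decidable_comp[OF assms(1)] computable_comp[OF computable_rank[OF assms(1)]])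
  then have "computable k"
    unfolding k_def using ex by (rule computable_Least)
  moreover have k: "P (k m)" "rank P (k m) = m" for m
    unfolding k_def using LeastI_ex[OF ex[of m]] by blast+
  have "bij_betw k UNIV {n. P n}"
  proof (rule bij_betw_byWitness[of _ "rank P"])
    show "\<forall>n\<in>{n. P n}. k (rank P n) = n"
      using k inj_onD[OF bij_betw_imp_inj_on[OF bij]] by simp
  qed (auto simp: k)
  ultimately show thesis
    by (rule that)
qed

text \<open>Of all witnesses that \<open>n \<in> S\<close> keep only the first one, so that nothing is listed twice.\<close>

lemma semidecidable_enumeration:
  assumes "semidecidable S" and "infinite S"
  obtains k where "computable k" and "bij_betw k UNIV S"
proof -
  obtain P where P: "decidable P" and S: "S = {n. \<exists>t. P (pair t n)}"
    using assms by (auto simp: semidecidable_def)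
  define Q where "Q z \<longleftrightarrow> P z \<and> \<not> (\<exists>t<pfst z. P (pair t (psnd z)))" for z
  have "decidable Q"
    unfolding Q_def by (intro computable_intros P decidable_comp[OF P])
  have bij: "bij_betw psnd {z. Q z} S"
  proof (rule bij_betw_byWitness[of _ "\<lambda>n. pair (LEAST t. P (pair t n)) n"])
    show "\<forall>z\<in>{z. Q z}. pair (LEAST t. P (pair t (psnd z))) (psnd z) = z"
    proof
      fix z assume "z \<in> {z. Q z}"
      then have "(LEAST t. P (pair t (psnd z))) = pfst z"
        by (intro Least_equality) (auto simp: Q_def not_less[symmetric])
      then show "pair (LEAST t. P (pair t (psnd z))) (psnd z) = z"
        by simp
    qed
    show "psnd ` {z. Q z} \<subseteq> S"
      by (auto simp: Q_def S) (metis pair_collapse)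
    show "(\<lambda>n. pair (LEAST t. P (pair t n)) n) ` S \<subseteq> {z. Q z}"
      by (auto simp: Q_def S intro: LeastI dest: not_less_Least)
  qed simp
  then have "infinite {z. Q z}"
    using assms(2) bij_betw_finite by blast
  then obtain k where k: "computable k" "bij_betw k UNIV {z. Q z}"
    using decidable_enumeration \<open>decidable Q\<close> by blast
  show thesis
  proof (rule that)
    show "computable (\<lambda>n. psnd (k n))"
      by (intro computable_intros k)
    show "bij_betw (\<lambda>n. psnd (k n)) UNIV S"
      using bij_betw_trans[OF k(2) bij] by (simp add: comp_def)
  qed
qed

lemma decidable_if_bij_betw_UNIV:
  assumes "semidecidable S" and "infinite S" and "computable F" and "bij_betw F S UNIV"
  shows "decidable (\<lambda>n. n \<in> S)"
proof -
  obtain k where k: "computable k" "bij_betw k UNIV S"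
    using semidecidable_enumeration assms(1,2) by blast
  define m where "m n = (LEAST i. F (k i) = F n)" for n
  have ex: "\<exists>i. F (k i) = F n" for n
    using bij_betw_imp_surj_on[OF bij_betw_trans[OF k(2) assms(4)]] by (metis comp_apply rangeE UNIV_I)
  have "decidable (\<lambda>z. F (k (pfst z)) = F (psnd z))"
    by (intro computable_intros computable_comp[OF assms(3)] computable_comp[OF k(1)])
  then have "computable m"
    unfolding m_def using ex by (rule computable_Least)
  then have "decidable (\<lambda>n. n = k (m n))"
    by (intro computable_intros computable_comp[OF k(1)])
  moreover have "n = k (m n) \<longleftrightarrow> n \<in> S" for n
  proof -
    have "k (m n) \<in> S"
      using k(2) bij_betwE by blast
    moreover have "F (k (m n)) = F n"
      unfolding m_def using ex[of n] by (rule LeastI_ex)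
    ultimately show ?thesis
      using bij_betw_imp_inj_on[OF assms(4)] by (metis inj_onD)
  qed
  ultimately show ?thesis
    by simp
qed

text \<open>A variant of the halting set: \<open>e\<close>, run on its own number
  (\<open>pair e 0\<close> is \<open>encode [e]\<close>), outputs 0. Asking for output 0 instead of
  halting lets a characteristic function contradict itself directly, with no modified
  program.\<close>

definition diagonal_set :: "nat set" where
  "diagonal_set = {e. eval e (pair e 0) 0}"

lemma semidecidable_diagonal_set: "semidecidable diagonal_set"
proof -
  let ?P = "\<lambda>z. pair (psnd z) (pair (pair (psnd z) 0) 0) \<in> set_decode (stage (pfst z))"
  have "decidable ?P"
    by (intro computable_intros computable_comp[OF computable_stage])
  moreover have "diagonal_set = {n. \<exists>t. ?P (pair t n)}"
    by (simp add: diagonal_set_def eval_iff_stage)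
  ultimately show ?thesis
    unfolding semidecidable_def by blast
qed

lemma infinite_diagonal_set: "infinite diagonal_set"
proof
  assume "finite diagonal_set"
  \<comment> \<open>Every \<open>pair 0 c\<close> is a code of the constant 0, which gives
    infinitely many members.\<close>
  moreover have "range (pair 0) \<subseteq> diagonal_set"
    by (auto simp: diagonal_set_def)
  ultimately have "finite (range (pair 0))"
    by (rule rev_finite_subset)
  moreover have "inj (pair 0)"
    by (simp add: inj_def)
  ultimately show False
    using finite_imageD by blast
qed

lemma not_decidable_diagonal_set: "\<not> decidable (\<lambda>e. e \<in> diagonal_set)"
proof
  assume "decidable (\<lambda>e. e \<in> diagonal_set)"
  then have "partial_computable (\<lambda>e. Some (of_bool (e \<in> diagonal_set)))"
    by (simp add: decidable_def computable_iff_partial)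
  then obtain c where "\<And>x y. eval c (pair x 0) y \<longleftrightarrow> Some (of_bool (x \<in> diagonal_set)) = Some y"
    by (rule partial_computable_code) blast
  \<comment> \<open>Membership of \<open>c\<close> means that \<open>c\<close> outputs 0 on itself,
    but 0 is the answer for non-members.\<close>
  from this[of c 0] show False
    by (auto simp: diagonal_set_def)
qed

section \<open>Words\<close>

definition word_of :: "nat \<Rightarrow> word" where
  "word_of = inv word_code"

lemma word_of_word_code [simp]: "word_of (word_code w) = w"
  using bij_word_code by (simp add: word_of_def bij_is_inj)

lemma word_code_word_of [simp]: "word_code (word_of n) = n"
  using bij_word_code by (simp add: word_of_def bij_is_surj surj_f_inv_f)

lemma bij_word_of: "bij word_of"
  unfolding word_of_def using bij_word_code by (rule bij_imp_bij_inv)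

lemma mem_image_word_code: "n \<in> word_code ` B \<longleftrightarrow> word_of n \<in> B"
  by (metis imageE imageI word_code_word_of word_of_word_code)

lemma bij_betw_word_code: "bij_betw word_code B (word_code ` B)"
  using bij_word_code by (meson bij_is_inj inj_on_imp_bij_betw inj_on_subset subset_UNIV)

lemma F_PR_iff: "f \<in> F_PR \<longleftrightarrow> partial_computable (\<lambda>n. map_option word_code (f (word_of n)))"
  unfolding F_PR_def partial_computable_def mem_Collect_eq
  by (metis word_code_word_of word_of_word_code)

definition word_fun :: "(nat \<Rightarrow> nat) \<Rightarrow> word \<Rightarrow> word" where
  "word_fun k w = word_of (k (word_code w))"

lemma F_PR_comp:
  assumes "f \<in> F_PR" and "computable k"
  shows "map_option (word_fun k) \<circ> f \<in> F_PR"
proof -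
  obtain g where g: "partial_recursive 1 g" "\<And>w. g [word_code w] = map_option word_code (f w)"
    using assms(1) by (auto simp: F_PR_def)
  obtain h where h: "partial_recursive 1 h" "\<And>n. h [n] = Some (k n)"
    using assms(2) by (auto simp: computable_iff_partial partial_computable_def)
  have "partial_recursive 1 (pr_comp h [g])"
    using g(1) h(1) by (intro partial_recursive.comp) auto
  moreover have "pr_comp h [g] [word_code w] = map_option word_code ((map_option (word_fun k) \<circ> f) w)" for w
    by (cases "f w") (simp_all add: pr_comp_def g(2) h(2) word_fun_def)
  ultimately show ?thesis
    unfolding F_PR_def by blast
qed

lemma decidable_recursive_set:
  assumes "recursive_set B"
  shows "decidable (\<lambda>n. n \<in> word_code ` B)"
proof -
  have "partial_computable (\<lambda>n. map_option word_code (Some (if word_of n \<in> B then [True] else [False])))"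
    using assms by (simp add: recursive_set_def F_REC_def F_PR_iff)
  \<comment> \<open>The answers \<open>[True]\<close> and \<open>[False]\<close> have codes 2 and 1,
    so membership becomes a comparison with 2.\<close>
  moreover have "word_code [b] = (if b then 2 else 1)" for b
    using word_code_snoc[of "[]" b] by simp
  ultimately have "computable (\<lambda>n. if word_of n \<in> B then 2 else 1 :: nat)"
    by (simp add: computable_iff_partial if_distrib cong: if_cong)
  then have "decidable (\<lambda>n. (if word_of n \<in> B then 2 else 1) = (2 :: nat))"
    by (intro decidable_eq computable_const)
  also have "(\<lambda>n. (if word_of n \<in> B then 2 else 1) = (2 :: nat)) = (\<lambda>n. n \<in> word_code ` B)"
    by (auto simp: mem_image_word_code)
  finally show ?thesis .
qed

lemma semidecidable_re_set:
  assumes "re_set B"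
  shows "semidecidable (word_code ` B)"
proof -
  obtain f where f: "f \<in> F_PR" "dom f = B"
    using assms by (auto simp: re_set_def)
  have "dom (\<lambda>n. map_option word_code (f (word_of n))) = word_code ` B"
    by (auto simp: set_eq_iff mem_image_word_code domIff simp flip: f(2))
  then show ?thesis
    using semidecidable_dom f(1) F_PR_iff by metis
qed

lemma re_set_word_of:
  assumes "semidecidable S"
  shows "re_set (word_of ` S)"
proof -
  obtain p where p: "partial_computable p" "dom p = S"
    using semidecidable_obtain_dom assms by blast
  let ?f = "\<lambda>w. map_option word_of (p (word_code w))"
  have "?f \<in> F_PR"
    using p(1) by (simp add: F_PR_iff option.map_comp comp_def option.map_ident)
  moreover have "w \<in> word_of ` S \<longleftrightarrow> word_code w \<in> S" for w
    by (metis image_iff word_code_word_of word_of_word_code)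
  then have "dom ?f = word_of ` S"
    by (auto simp: set_eq_iff domIff simp flip: p(2))
  ultimately show ?thesis
    unfolding re_set_def by blast
qed

section \<open>Composing compression functions with bijections\<close>

lemma compression_function_comp:
  assumes "compression_function f A B" and "bij_betw h B C"
  shows "compression_function (map_option h \<circ> f) A C"
proof -
  have dom: "A \<subseteq> dom f" and ran: "ran (f |` A) = B"
    and inj: "\<And>a b. a \<in> A \<Longrightarrow> b \<in> A \<Longrightarrow> f a = f b \<Longrightarrow> a = b"
    using assms(1) by (auto simp: compression_function_def)
  \<comment> \<open>\<open>h\<close> is injective on \<open>B\<close> only, so the values of
    \<open>f\<close> on \<open>A\<close> are first located in \<open>B\<close>.\<close>
  have B: "\<exists>v\<in>B. f a = Some v" if "a \<in> A" for a
  proof -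
    obtain v where "f a = Some v"
      using \<open>a \<in> A\<close> dom by blast
    then have "v \<in> ran (f |` A)"
      using that by (auto intro: ranI[of _ a])
    then show ?thesis
      using ran \<open>f a = Some v\<close> by blast
  qed
  have "ran ((map_option h \<circ> f) |` A) = h ` ran (f |` A)"
    by (auto simp: ran_def restrict_map_def split: if_splits)
  moreover have "a = b" if "a \<in> A" "b \<in> A" "map_option h (f a) = map_option h (f b)" for a b
  proof -
    obtain u v where uv: "u \<in> B" "v \<in> B" "f a = Some u" "f b = Some v"
      using B[OF \<open>a \<in> A\<close>] B[OF \<open>b \<in> A\<close>] by blast
    then have "u = v"
      using that(3) inj_onD[OF bij_betw_imp_inj_on[OF assms(2)]] by simp
    then show ?thesis
      using uv inj that(1,2) by simp
  qed
  ultimately show ?thesis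
    using dom ran bij_betw_imp_surj_on[OF assms(2)] by (auto simp: compression_function_def)
qed

lemma compressible_UNIV_if_recursive_set:
  assumes "infinite B" and "recursive_set B" and "compressible F_PR A B"
  shows "compressible F_PR A UNIV"
proof -
  let ?P = "\<lambda>n. n \<in> word_code ` B"
  obtain f where f: "f \<in> F_PR" "compression_function f A B"
    using assms(3) by (auto simp: compressible_def)
  have "computable (rank ?P)"
    using assms(2) by (intro computable_rank decidable_recursive_set)
  then have "map_option (word_fun (rank ?P)) \<circ> f \<in> F_PR"
    using f(1) by (intro F_PR_comp)
  moreover have "infinite {n. ?P n}"
    using assms(1) bij_betw_finite[OF bij_betw_word_code[of B]] by simp
  then have "bij_betw (word_of \<circ> (rank ?P \<circ> word_code)) B UNIV"
    using bij_betw_rank[of ?P] by (intro bij_betw_trans[OF _ bij_word_of] bij_betw_trans[OF bij_betw_word_code]) simp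
  then have "bij_betw (word_fun (rank ?P)) B UNIV"
    by (simp add: word_fun_def[abs_def] comp_def)
  then have "compression_function (map_option (word_fun (rank ?P)) \<circ> f) A UNIV"
    by (rule compression_function_comp[OF f(2)])
  ultimately show ?thesis
    by (auto simp: compressible_def)
qed

text \<open>Serves both the converse half of (1), where a recursive set is in particular
  semidecidable, and all of (2).\<close>

lemma compression_onto_semidecidable:
  assumes "infinite B" and "semidecidable (word_code ` B)" and "compressible F_PR A UNIV"
  shows "\<exists>f\<in>F_PR. compression_function f A B \<and> ran f = B"
proof -
  obtain f where f: "f \<in> F_PR" "compression_function f A UNIV"
    using assms(3) by (auto simp: compressible_def)
  have "infinite (word_code ` B)"
    using assms(1) bij_betw_finite[OF bij_betw_word_code[of B]] by simp
  then obtain k where k: "computable k" "bij_betw k UNIV (word_code ` B)"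
    using semidecidable_enumeration assms(2) by blast
  have "bij_betw word_of (word_code ` B) B"
    by (rule bij_betw_subset[OF bij_word_of]) (simp_all add: image_image)
  then have "bij_betw (word_of \<circ> (k \<circ> word_code)) UNIV B"
    by (rule bij_betw_trans[OF bij_betw_trans[OF bij_word_code k(2)]])
  then have bij: "bij_betw (word_fun k) UNIV B"
    by (simp add: word_fun_def[abs_def] comp_def)
  define g where "g = map_option (word_fun k) \<circ> f"
  have g: "g \<in> F_PR" "compression_function g A B"
    unfolding g_def using F_PR_comp f(1) k(1) compression_function_comp[OF f(2) bij] by blast+
  \<comment> \<open>\<open>f\<close> may also be defined outside \<open>A\<close>; there too
    \<open>word_fun k\<close> sends its values into \<open>B\<close>, which gives the stronger claim
    on the full range.\<close>
  have "ran g \<subseteq> B"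
    using bij_betw_imp_surj_on[OF bij] by (auto simp: g_def ran_def)
  moreover have "B \<subseteq> ran g"
    using g(2) by (auto simp: compression_function_def ran_def restrict_map_def split: if_splits)
  ultimately show ?thesis
    using g by blast
qed

lemma compressible_not_onto_UNIV:
  defines "K \<equiv> word_of ` diagonal_set"
  shows "infinite K" and "re_set K" and "compressible F_REC K K" and "\<not> compressible F_REC K UNIV"
proof -
  have code: "word_code ` K = diagonal_set"
    by (simp add: K_def image_image)
  show "infinite K"
    using infinite_diagonal_set code by (metis finite_imageI)
  show "re_set K"
    unfolding K_def by (rule re_set_word_of[OF semidecidable_diagonal_set])
  have "Some \<in> F_REC"
    using computable_id by (auto simp: F_REC_def F_PR_iff computable_iff_partial)
  moreover have "compression_function Some K K"
    by (auto simp: compression_function_def ran_def restrict_map_def)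
  ultimately show "compressible F_REC K K"
    by (auto simp: compressible_def)
  show "\<not> compressible F_REC K UNIV"
  proof
    assume "compressible F_REC K UNIV"
    then obtain f where f: "f \<in> F_PR" "dom f = UNIV" and comp: "compression_function f K UNIV"
      by (auto simp: compressible_def F_REC_def)
    define h where "h w = the (f w)" for w
    have h: "f w = Some (h w)" for w
      using f(2) by (simp add: h_def) (metis UNIV_I domIff option.exhaust_sel)
    have "computable (\<lambda>n. word_code (h (word_of n)))"
      using f(1) by (simp add: F_PR_iff h computable_iff_partial)
    moreover have "bij_betw h K UNIV"
      using comp by (auto simp: compression_function_def h bij_betw_def inj_on_def ran_def restrict_map_def
          set_eq_iff image_iff split: if_splits) metis
    then have "bij_betw (word_code \<circ> (h \<circ> word_of)) diagonal_set UNIV"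
      using bij_betw_subset[OF bij_word_of subset_UNIV, of diagonal_set K]
      by (intro bij_betw_trans[OF _ bij_word_code] bij_betw_trans[where B = K]) (simp_all add: K_def)
    ultimately have "decidable (\<lambda>e. e \<in> diagonal_set)"
      by (intro decidable_if_bij_betw_UNIV semidecidable_diagonal_set infinite_diagonal_set)
        (auto simp: comp_def)
    then show False
      using not_decidable_diagonal_set by contradiction
  qed
qed

theorem theorem8:
  shows "(\<forall>A B :: word set. infinite A \<and> infinite B \<and> recursive_set B \<longrightarrow>
            (compressible F_PR A B \<longleftrightarrow> compressible F_PR A UNIV)) \<and>
         (\<forall>A B :: word set. infinite A \<and> infinite B \<and> re_set B \<longrightarrow>
            compressible F_PR A UNIV \<longrightarrow>
              compressible F_PR A B \<and>
              (\<exists>f\<in>F_PR. compression_function f A B \<and> ran f = B)) \<and>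
         (\<exists>A B :: word set. infinite A \<and> infinite B \<and> re_set B \<and>
            compressible F_REC A B \<and> \<not> compressible F_REC A UNIV)"
proof (intro conjI allI impI iffI)
  fix A B :: "word set"
  assume "infinite A \<and> infinite B \<and> recursive_set B" and "compressible F_PR A B"
  then show "compressible F_PR A UNIV"
    using compressible_UNIV_if_recursive_set by blast
next
  fix A B :: "word set"
  assume B: "infinite A \<and> infinite B \<and> recursive_set B" and "compressible F_PR A UNIV"
  moreover have "semidecidable (word_code ` B)"
    using decidable_imp_semidecidable[OF decidable_recursive_set[of B]] B by simp
  ultimately show "compressible F_PR A B"
    unfolding compressible_def[of _ A B] using compression_onto_semidecidable by blast
next
  fix A B :: "word set"
  assume "infinite A \<and> infinite B \<and> re_set B" and "compressible F_PR A UNIV"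
  then have "\<exists>f\<in>F_PR. compression_function f A B \<and> ran f = B"
    using compression_onto_semidecidable semidecidable_re_set by blast
  then show "compressible F_PR A B" "\<exists>f\<in>F_PR. compression_function f A B \<and> ran f = B"
    by (auto simp: compressible_def)
next
  show "\<exists>A B :: word set. infinite A \<and> infinite B \<and> re_set B \<and>
          compressible F_REC A B \<and> \<not> compressible F_REC A UNIV"
    using compressible_not_onto_UNIV by blast
qed

end
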